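(* If $G$ is a slender generalized group and $a\in G$, then the group $G_{e(a)}=\{g\in G\mid e(g)=e(a)\}$, with the operation of $G$, is a slender group (in the classical sense).
   Context: A generalized group is a semigroup $G$ such that (1) for each $x\in G$ there is a unique element $e(x)\in G$ with $e(x)x=xe(x)=x$, and (2) for each $x\in G$ there is $y\in G$ with $xy=yx=e(x)$. A homomorphism of generalized groups is a map $f:G\to H$ with $f(ab)=f(a)f(b)$ for all $a,b\in G$. It is known that, for $a\in G$, the set $G_{e(a)}$ is a group under the operation of $G$. Let $\mathbb{N}=\{1,2,3,\ldots\}$. For $n\in\mathbb{N}$, $i_n\in\prod_{\mathbb{N}}\mathbb{Z}$ denotes the sequence with $i_n(n)=1$ and $i_n(k)=0$ for $k\neq n$. With its usual coordinatewise addition, $\prod_{\mathbb{N}}\mathbb{Z}$ is an abelian group. The classical notion of slender group is defined for abelian groups: an abelian group $A$ is slender if for every homomorphism $h:\prod_{\mathbb{N}}\mathbb{Z}\to A$ the set $\{n\in\mathbb{N}\mid h(i_n)\neq 0\}$ is finite. $\prod_{\mathbb{N}}^{g}\mathbb{Z}$ denotes the generalized group with underlying set $\prod_{\mathbb{N}}\mathbb{Z}$ and operation $(x_1,x_2,x_3,x_4,x_5,x_6,\ldots)*(y_1,y_2,y_3,y_4,y_5,y_6,\ldots)=(x_1,y_2,x_3+y_3,x_4,y_5,x_6+y_6,\ldots)$, that is, $(x*y)_k=x_k$ if $k\equiv 1\pmod 3$, $(x*y)_k=y_k$ if $k\equiv 2\pmod 3$, and $(x*y)_k=x_k+y_k$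 if $k\equiv 0\pmod 3$. A generalized group $G$ is slender (a slender generalized group) if for every homomorphism of generalized groups $h:\prod_{\mathbb{N}}^{g}\mathbb{Z}\to G$ the set $\{n\in\mathbb{N}\mid h(i_n)\neq e(h(i_n))\}$ is finite.
   Formalization: The group G_{e(a)} need not be abelian (e.g. a free group on two generators), so "slender group" is here read as any group, abelian or not, for which every homomorphism from the group of integer sequences sends all but finitely many i_n to the identity; commutativity is not claimed. *)

theory Defs
  imports "HOL-Algebra.Algebra"
begin

(* Generalized groups are represented by the library's monoid records, so that
   the library's hom, which refers to carrier and multiplication only, is
   literally the notion of homomorphism of generalized groups.  A generalized
   group has no distinguished unit, and no definition below reads the field one
   of such a record. *)

definition gg_id :: "('a, 'b) monoid_scheme \<Rightarrow> 'a \<Rightarrow> 'a" where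
  "gg_id G x = (THE u. u \<in> carrier G \<and> u \<otimes>\<^bsub>G\<^esub> x = x \<and> x \<otimes>\<^bsub>G\<^esub> u = x)"

locale generalized_group =
  fixes G :: "('a, 'b) monoid_scheme" (structure)
  assumes m_closed: "x \<in> carrier G \<Longrightarrow> y \<in> carrier G \<Longrightarrow> x \<otimes> y \<in> carrier G"
    and m_assoc: "x \<in> carrier G \<Longrightarrow> y \<in> carrier G \<Longrightarrow> z \<in> carrier G \<Longrightarrow>
      (x \<otimes> y) \<otimes> z = x \<otimes> (y \<otimes> z)"
    and ex1_id: "x \<in> carrier G \<Longrightarrow> \<exists>!u. u \<in> carrier G \<and> u \<otimes> x = x \<and> x \<otimes> u = x"
    and ex_inv: "x \<in> carrier G \<Longrightarrow> \<exists>y\<in>carrier G. x \<otimes> y = gg_id G x \<and> y \<otimes> x = gg_id G x"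

(* G_{e(a)} with the operation of G; here the field one does matter, because the
   result is regarded as a group. *)
definition gg_component :: "('a, 'b) monoid_scheme \<Rightarrow> 'a \<Rightarrow> 'a monoid" where
  "gg_component G a =
    \<lparr>carrier = {g \<in> carrier G. gg_id G g = gg_id G a}, monoid.mult = monoid.mult G, one = gg_id G a\<rparr>"

(* Sequences are indexed by {1, 2, 3, ...}; as usual for PiE their value at the
   junk index 0 is undefined. *)
abbreviation int_seq_group :: "(nat \<Rightarrow> int) monoid" where
  "int_seq_group \<equiv> product_group {1..} (\<lambda>_. integer_group)"

definition int_seq_gen_group :: "(nat \<Rightarrow> int) monoid" where
  "int_seq_gen_group =
    \<lparr>carrier = carrier int_seq_group,
     monoid.mult = (\<lambda>x y. \<lambda>k\<in>{1..}.
       if k mod 3 = 1 then x k else if k mod 3 = 2 then y k else x k + y k),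
     one = undefined\<rparr>"

definition unit_seq :: "nat \<Rightarrow> nat \<Rightarrow> int" where
  "unit_seq n = (\<lambda>k\<in>{1..}. if k = n then 1 else 0)"

(* For an abelian group this is exactly the classical notion.  Commutativity is
   not made part of the predicate: the groups G_{e(a)} of a slender generalized
   group G need not be abelian.  For example, a free group is a slender
   generalized group, with itself as its only G_{e(a)}, because homomorphisms
   from the group of integer sequences to it have cyclic image. *)
definition slender_group :: "('a, 'b) monoid_scheme \<Rightarrow> bool" where
  "slender_group A \<longleftrightarrow> group A \<and>
    (\<forall>h \<in> hom int_seq_group A. finite {n \<in> {1..}. h (unit_seq n) \<noteq> \<one>\<^bsub>A\<^esub>})"

definition slender_generalized_group :: "('a, 'b) monoid_scheme \<Rightarrow> bool" where
  "slender_generalized_group G \<longleftrightarrow> generalized_group G \<and>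
    (\<forall>h \<in> hom int_seq_gen_group G.
      finite {n \<in> {1..}. h (unit_seq n) \<noteq> gg_id G (h (unit_seq n))})"

end

theory Submission
  imports Defs
begin

text \<open>
  The coordinates whose index is divisible by 3 are the only ones on which the generalized group of
  integer sequences adds. Reading off just these coordinates is therefore a homomorphism onto the
  ordinary group of integer sequences, and it carries the unit sequence at \<open>3n\<close> to the
  unit sequence at \<open>n\<close>. Given a homomorphism \<open>h\<close> from the group of integer
  sequences to \<open>G\<^bsub>e(a)\<^esub>\<close>, its composition with this projection is a
  homomorphism into \<open>G\<close>. All its values \<open>g\<close> satisfy
  \<open>e(g) = e(a)\<close>, so slenderness of \<open>G\<close> says that only finitely many unit
  sequences are sent to something other than the unit \<open>e(a)\<close> of the component; restricted to the
  indices \<open>3n\<close> this is the finiteness required of \<open>h\<close>.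
\<close>

context generalized_group
begin

lemma gg_id_unique:
  assumes "x \<in> carrier G" "u \<in> carrier G" "u \<otimes> x = x" "x \<otimes> u = x"
  shows "gg_id G x = u"
  unfolding gg_id_def using ex1_id[OF assms(1)] assms by (intro the1_equality) auto

lemma
  assumes "x \<in> carrier G"
  shows gg_id_closed: "gg_id G x \<in> carrier G"
    and gg_id_mult_left: "gg_id G x \<otimes> x = x"
    and gg_id_mult_right: "x \<otimes> gg_id G x = x"
proof -
  have "gg_id G x \<in> carrier G \<and> gg_id G x \<otimes> x = x \<and> x \<otimes> gg_id G x = x"
    unfolding gg_id_def by (rule theI') (rule ex1_id[OF assms])
  then show "gg_id G x \<in> carrier G" "gg_id G x \<otimes> x = x" "x \<otimes> gg_id G x = x"
    by auto
qed

text \<open>Both \<open>e(x)\<close> and its square act as two-sided identities of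
  \<open>x\<close>, and there is only one such element.\<close>

lemma gg_id_idem:
  assumes "x \<in> carrier G"
  shows "gg_id G x \<otimes> gg_id G x = gg_id G x"
proof -
  let ?u = "gg_id G x"
  note id = gg_id_closed[OF assms] gg_id_mult_left[OF assms] gg_id_mult_right[OF assms]
  have "(?u \<otimes> ?u) \<otimes> x = x"
    using assms id by (simp add: m_assoc)
  moreover have "x \<otimes> (?u \<otimes> ?u) = x"
    using assms id by (simp add: m_assoc[symmetric])
  ultimately show ?thesis
    using gg_id_unique assms id m_closed by metis
qed

text \<open>The inverse of \<open>x\<close> supplied by the axioms may lie outside the component;
  multiplying it by \<open>e(a)\<close> on both sides moves it into the component, by uniqueness of
  identities, without changing its products with \<open>x\<close>.\<close>

lemma group_gg_component:
  assumes a: "a \<in> carrier G"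
  shows "group (gg_component G a)"
proof (rule groupI)
  let ?u = "gg_id G a" and ?C = "gg_component G a"
  have u: "?u \<in> carrier G" "?u \<otimes> ?u = ?u"
    using gg_id_closed[OF a] gg_id_idem[OF a] by auto
  have C_iff: "x \<in> carrier ?C \<longleftrightarrow> x \<in> carrier G \<and> ?u \<otimes> x = x \<and> x \<otimes> ?u = x" for x
    unfolding gg_component_def using gg_id_unique[OF _ u(1)] gg_id_mult_left gg_id_mult_right
    by force
  show "\<one>\<^bsub>?C\<^esub> \<in> carrier ?C"
    unfolding C_iff using u by (simp add: gg_component_def)
  show "x \<otimes>\<^bsub>?C\<^esub> y \<in> carrier ?C" if "x \<in> carrier ?C" "y \<in> carrier ?C" for x y
  proof -
    have "?u \<otimes> (x \<otimes> y) = x \<otimes> y"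
      using that u unfolding C_iff by (simp flip: m_assoc)
    then show ?thesis
      using that u unfolding C_iff by (simp add: gg_component_def m_closed m_assoc)
  qed
  show "x \<otimes>\<^bsub>?C\<^esub> y \<otimes>\<^bsub>?C\<^esub> z = x \<otimes>\<^bsub>?C\<^esub> (y \<otimes>\<^bsub>?C\<^esub> z)"
    if "x \<in> carrier ?C" "y \<in> carrier ?C" "z \<in> carrier ?C" for x y z
    using that by (simp add: gg_component_def m_assoc)
  show "\<one>\<^bsub>?C\<^esub> \<otimes>\<^bsub>?C\<^esub> x = x" if "x \<in> carrier ?C" for x
    using that unfolding C_iff by (simp add: gg_component_def)
  show "\<exists>y\<in>carrier ?C. y \<otimes>\<^bsub>?C\<^esub> x = \<one>\<^bsub>?C\<^esub>" if x: "x \<in> carrier ?C" for x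
  proof -
    have xG: "x \<in> carrier G" "?u \<otimes> x = x" "x \<otimes> ?u = x" "gg_id G x = ?u"
      using x C_iff by (auto simp: gg_component_def)
    obtain y where y: "y \<in> carrier G" "y \<otimes> x = ?u"
      using ex_inv[OF xG(1)] xG(4) by auto
    let ?y = "?u \<otimes> (y \<otimes> ?u)"
    have "?u \<otimes> ?y = ?y"
      using u y by (simp add: m_closed flip: m_assoc)
    moreover have "?y \<otimes> ?u = ?y"
      using u y by (simp add: m_closed m_assoc)
    ultimately have "?y \<in> carrier ?C"
      unfolding C_iff using u y m_closed by simp
    moreover have "?y \<otimes> x = ?u"
      using u y xG by (simp add: m_closed m_assoc)
    ultimately show ?thesis
      by (intro bexI[of _ ?y]) (auto simp: gg_component_def)
  qed
qed

end

definition third_coordinates :: "(nat \<Rightarrow> int) \<Rightarrow> nat \<Rightarrow> int" where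
  "third_coordinates x = (\<lambda>k\<in>{1..}. x (3 * k))"

lemma third_coordinates_hom: "third_coordinates \<in> hom int_seq_gen_group int_seq_group"
  by (auto simp: hom_def third_coordinates_def int_seq_gen_group_def fun_eq_iff)

lemma third_coordinates_unit_seq: "third_coordinates (unit_seq (3 * n)) = unit_seq n"
  by (auto simp: third_coordinates_def unit_seq_def fun_eq_iff)

lemma unit_seq_in_carrier: "unit_seq n \<in> carrier int_seq_group"
  by (simp add: unit_seq_def)

theorem proposition1p8:
  fixes G :: "('a, 'b) monoid_scheme" and a :: 'a
  assumes "slender_generalized_group G" and "a \<in> carrier G"
  shows "slender_group (gg_component G a)"
  unfolding slender_group_def
proof (intro conjI ballI)
  interpret generalized_group G
    using assms(1) by (simp add: slender_generalized_group_def)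
  let ?C = "gg_component G a"
  show "group ?C"
    by (rule group_gg_component[OF assms(2)])
  fix h assume h: "h \<in> hom int_seq_group ?C"
  let ?h = "h \<circ> third_coordinates"
  have "?h \<in> hom int_seq_gen_group ?C"
    using third_coordinates_hom h by (rule hom_compose)
  then have "?h \<in> hom int_seq_gen_group G"
    by (auto simp: hom_def gg_component_def)
  then have fin: "finite {m \<in> {1..}. ?h (unit_seq m) \<noteq> gg_id G (?h (unit_seq m))}" (is "finite ?M")
    using assms(1) unfolding slender_generalized_group_def by blast
  have "gg_id G (h (unit_seq n)) = \<one>\<^bsub>?C\<^esub>" for n
    using hom_in_carrier[OF h unit_seq_in_carrier] by (simp add: gg_component_def)
  then have "{n \<in> {1..}. h (unit_seq n) \<noteq> \<one>\<^bsub>?C\<^esub>} \<subseteq> (\<lambda>n. 3 * n) -` ?M"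
    by (auto simp: third_coordinates_unit_seq)
  moreover have "finite ((\<lambda>n. 3 * n) -` ?M)"
    using fin by (rule finite_vimageI) (simp add: inj_on_def)
  ultimately show "finite {n \<in> {1..}. h (unit_seq n) \<noteq> \<one>\<^bsub>?C\<^esub>}"
    by (rule finite_subset)
qed

end
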